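(* Let $X$ be a locally compact Hausdorff space. Then $\tau_{hco}$ is the smallest Hausdorff topology on $\Gamma(X)$ that makes it a topological inverse semigroup such that the evaluation map $ev:\Gamma(X)\ast X\to X$, $ev(f,x)=f(x)$, is continuous and $\Gamma(X)\ast X$ is open in $\Gamma(X)\times X$, where $\Gamma(X)\ast X=\{(f,x)\in\Gamma(X)\times X: x\in\mathrm{dom}(f)\}$.
   Context: $\Gamma(X)$ is the inverse semigroup of all homeomorphisms $f:\mathrm{dom}(f)\to\mathrm{im}(f)$ between open subsets of $X$, under composition of partial maps: $\mathrm{dom}(f\circ g)=\{x\in\mathrm{dom}(g): g(x)\in\mathrm{dom}(f)\}$. A topological inverse semigroup is an inverse semigroup with a topology making multiplication and inversion continuous. For $K\subseteq X$ compact and $V\subseteq X$ open, $\langle K;V\rangle=\{f\in\Gamma(X): K\subseteq\mathrm{dom}(f),\ f(K)\subseteq V\}$ and $\langle K;V\rangle^{-1}=\{f\in\Gamma(X): f^{-1}\in\langle K;V\rangle\}$; $\tau_{ico}$ is the topology on $\Gamma(X)$ generated by all these sets. $CL(X)$ is the set of closed subsets of $X$ (including $\emptyset$) with the Fell topology, whose subbasis consists of $V^-=\{A: A\cap V\neq\emptyset\}$ for $V$ open and $W^+=\{A: A\subseteq W\}$ for $W$ open with $X\setminus W$ compact. Let $\mathsf{D}(f)=X\setminus\mathrm{dom}(f)$ and $\mathsf{I}(f)=X\setminus\mathrm{im}(f)$. The topology $\tau_{hco}$ on $\Gamma(X)$ is generated by $\tau_{ico}$ together with the sets $\mathsf{D}^{-1}(U)$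 and $\mathsf{I}^{-1}(U)$ for $U$ Fell-open in $CL(X)$. *)

theory Defs
  imports "HOL-Analysis.Analysis"
begin

section \<open>Topological inverse semigroups\<close>

definition inverse_semigroup_on :: "'s set \<Rightarrow> ('s \<Rightarrow> 's \<Rightarrow> 's) \<Rightarrow> bool" where
  "inverse_semigroup_on S mul \<longleftrightarrow>
     (\<forall>a\<in>S. \<forall>b\<in>S. mul a b \<in> S) \<and>
     (\<forall>a\<in>S. \<forall>b\<in>S. \<forall>c\<in>S. mul (mul a b) c = mul a (mul b c)) \<and>
     (\<forall>a\<in>S. \<exists>!b. b \<in> S \<and> mul (mul a b) a = a \<and> mul (mul b a) b = b)"

definition semigroup_inverse :: "'s set \<Rightarrow> ('s \<Rightarrow> 's \<Rightarrow> 's) \<Rightarrow> 's \<Rightarrow> 's" where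
  "semigroup_inverse S mul a = (THE b. b \<in> S \<and> mul (mul a b) a = a \<and> mul (mul b a) b = b)"

definition topological_inverse_semigroup :: "'s topology \<Rightarrow> ('s \<Rightarrow> 's \<Rightarrow> 's) \<Rightarrow> bool" where
  "topological_inverse_semigroup T mul \<longleftrightarrow>
     inverse_semigroup_on (topspace T) mul \<and>
     continuous_map (prod_topology T T) T (\<lambda>(a, b). mul a b) \<and>
     continuous_map T T (semigroup_inverse (topspace T) mul)"

section \<open>The partial homeomorphisms of a space\<close>

text \<open>Partial maps on \<open>X\<close> are modelled by the library type \<open>'a \<rightharpoonup> 'a\<close>: \<open>dom f\<close> and \<open>ran f\<close> are the
  domain and the image, and composition of partial maps is \<open>f \<circ>\<^sub>m g\<close>, with
  \<open>dom (f \<circ>\<^sub>m g) = {x \<in> dom g. the (g x) \<in> dom f}\<close>. The empty map is a partial homeomorphism.\<close>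

definition partial_homeos :: "'a topology \<Rightarrow> ('a \<rightharpoonup> 'a) set" where
  "partial_homeos X = {f. openin X (dom f) \<and> openin X (ran f) \<and>
     homeomorphic_map (subtopology X (dom f)) (subtopology X (ran f)) (\<lambda>x. the (f x))}"

definition partial_inverse :: "('a \<rightharpoonup> 'a) \<Rightarrow> ('a \<rightharpoonup> 'a)" where
  "partial_inverse f = (\<lambda>y. if y \<in> ran f then Some (THE x. f x = Some y) else None)"

definition eval_domain :: "'a topology \<Rightarrow> (('a \<rightharpoonup> 'a) \<times> 'a) set" where
  "eval_domain X = {(f, x). f \<in> partial_homeos X \<and> x \<in> dom f}"

definition eval_map :: "('a \<rightharpoonup> 'a) \<times> 'a \<Rightarrow> 'a" where
  "eval_map = (\<lambda>(f, x). the (f x))"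

section \<open>The topologies\<close>

text \<open>\<^const>\<open>topology_generated_by\<close> uses the union of the subbasis as the underlying set. For each of
  the subbases below this union is the intended set.\<close>

definition compact_open_set :: "'a topology \<Rightarrow> 'a set \<Rightarrow> 'a set \<Rightarrow> ('a \<rightharpoonup> 'a) set" where
  "compact_open_set X K V =
     {f \<in> partial_homeos X. K \<subseteq> dom f \<and> (\<lambda>x. the (f x)) ` K \<subseteq> V}"

definition inv_compact_open_set :: "'a topology \<Rightarrow> 'a set \<Rightarrow> 'a set \<Rightarrow> ('a \<rightharpoonup> 'a) set" where
  "inv_compact_open_set X K V =
     {f \<in> partial_homeos X. partial_inverse f \<in> compact_open_set X K V}"

definition tau_ico :: "'a topology \<Rightarrow> ('a \<rightharpoonup> 'a) topology" where
  "tau_ico X = topology_generated_by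
     ({compact_open_set X K V | K V. compactin X K \<and> openin X V} \<union>
      {inv_compact_open_set X K V | K V. compactin X K \<and> openin X V})"

definition fell_topology :: "'a topology \<Rightarrow> 'a set topology" where
  "fell_topology X = topology_generated_by
     ({{A. closedin X A \<and> A \<inter> V \<noteq> {}} | V. openin X V} \<union>
      {{A. closedin X A \<and> A \<subseteq> W} | W. openin X W \<and> compactin X (topspace X - W)})"

definition dom_compl :: "'a topology \<Rightarrow> ('a \<rightharpoonup> 'a) \<Rightarrow> 'a set" where
  "dom_compl X f = topspace X - dom f"

definition im_compl :: "'a topology \<Rightarrow> ('a \<rightharpoonup> 'a) \<Rightarrow> 'a set" where
  "im_compl X f = topspace X - ran f"

definition tau_hco :: "'a topology \<Rightarrow> ('a \<rightharpoonup> 'a) topology" where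
  "tau_hco X = topology_generated_by
     ({U. openin (tau_ico X) U} \<union>
      {{f \<in> partial_homeos X. dom_compl X f \<in> U} | U. openin (fell_topology X) U} \<union>
      {{f \<in> partial_homeos X. im_compl X f \<in> U} | U. openin (fell_topology X) U})"

definition admissible_topology :: "'a topology \<Rightarrow> ('a \<rightharpoonup> 'a) topology \<Rightarrow> bool" where
  "admissible_topology X T \<longleftrightarrow>
     topspace T = partial_homeos X \<and>
     Hausdorff_space T \<and>
     topological_inverse_semigroup T (\<circ>\<^sub>m) \<and>
     continuous_map (subtopology (prod_topology T X) (eval_domain X)) X eval_map \<and>
     openin (prod_topology T X) (eval_domain X)"

end

theory Submission
  imports Defs
begin

text \<open>
  Everything rests on a subbasis of \<^term>\<open>tau_hco X\<close>: the sets \<open>\<langle>K;V\<rangle>\<close>, the sets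
  \<open>{f. \<not> V \<subseteq> dom f}\<close> with \<open>V\<close> open, and the inverses of both (\<open>tau_hco_eq\<close>).
  The second kind is the preimage under \<open>f \<mapsto> X - dom f\<close> of the Fell hit sets. The Fell miss sets
  give nothing new, since \<open>X - dom f \<subseteq> W\<close> means \<open>f \<in> \<langle>X - W; X\<rangle>\<close>. As this subbasis is closed
  under inversion, inversion is continuous, and because \<open>(f g)\<^sup>-\<^sup>1 = g\<^sup>-\<^sup>1 f\<^sup>-\<^sup>1\<close> the
  continuity of multiplication only has to be tested on the first two kinds of sets.

  \<^emph>\<open>Admissibility.\<close> Local compactness supplies, between a compact set and an open set containing
  it, a compact neighbourhood \<open>C\<close> (\<open>compact_neighbourhood_between\<close>). With it the evaluation map
  and the sets \<open>\<langle>K;V\<rangle>\<close> are treated as for the compact-open topology. The set \<open>{f. \<not> V \<subseteq> dom f}\<close>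
  is the delicate one (\<open>multiplication_nbhd_domain_misses\<close>): if \<open>x \<in> V\<close> and \<open>g x \<notin> dom f\<close>, then
  for \<open>f'\<close> near \<open>f\<close> the domain still omits some \<open>z\<close> near \<open>g x\<close>, and for \<open>g'\<close> near \<open>g\<close> the
  point \<open>g'\<^sup>-\<^sup>1 z\<close> exists and lies in \<open>V\<close>. Two maps are separated by their values at a
  common point, or by a compact neighbourhood that one domain contains and the other does not.

  \<^emph>\<open>Minimality.\<close> Let \<open>T\<close> be admissible. Continuous evaluation on an open domain makes every
  \<open>\<langle>K;V\<rangle>\<close> open in \<open>T\<close>, by the tube lemma. The decisive point is that \<open>V \<subseteq> dom f\<close> is an
  equation in the inverse semigroup, namely \<open>f\<^sup>-\<^sup>1 f e = e\<close> for the idempotent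
  \<open>e = id\<^sub>V\<close>. Solution sets of such equations are closed in a Hausdorff topological inverse
  semigroup, so \<open>{f. \<not> V \<subseteq> dom f}\<close> is open in \<open>T\<close> (\<open>openin_admissible_domain_misses\<close>).
\<close>

section \<open>The algebra of partial homeomorphisms\<close>

definition partial_preimage :: "('a \<rightharpoonup> 'a) \<Rightarrow> 'a set \<Rightarrow> 'a set" where
  "partial_preimage f V = {x. \<exists>y\<in>V. f x = Some y}"

lemma partial_inverse_eq_Some_iff:
  assumes "inj_on f (dom f)"
  shows "partial_inverse f y = Some x \<longleftrightarrow> f x = Some y"
proof -
  have "(THE x. f x = Some y) = x" if "f x = Some y" for x
    using assms that by (intro the_equality) (auto simp: inj_on_def dom_def)
  then show ?thesis
    unfolding partial_inverse_def ran_def by auto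
qed

lemma dom_partial_inverse [simp]: "dom (partial_inverse f) = ran f"
  by (auto simp: partial_inverse_def dom_def)

lemma inj_on_partial_inverse:
  assumes "inj_on f (dom f)"
  shows "inj_on (partial_inverse f) (dom (partial_inverse f))"
proof (rule inj_onI)
  fix y z assume "y \<in> dom (partial_inverse f)" "partial_inverse f y = partial_inverse f z"
  then obtain x where "partial_inverse f y = Some x" "partial_inverse f z = Some x"
    by (metis domD)
  then show "y = z" using partial_inverse_eq_Some_iff[OF assms] by auto
qed

lemma partial_inverse_partial_inverse:
  assumes "inj_on f (dom f)"
  shows "partial_inverse (partial_inverse f) = f"
proof
  fix x
  have "partial_inverse (partial_inverse f) x = Some y \<longleftrightarrow> f x = Some y" for y
    using partial_inverse_eq_Some_iff[OF assms]
      partial_inverse_eq_Some_iff[OF inj_on_partial_inverse[OF assms]] by simp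
  then show "partial_inverse (partial_inverse f) x = f x"
    by (metis option.exhaust)
qed

lemma partial_preimage_map_comp:
  "partial_preimage (f \<circ>\<^sub>m g) V = partial_preimage g (partial_preimage f V)"
  by (auto simp: partial_preimage_def map_comp_Some_iff)

lemma inj_on_map_comp:
  assumes f: "inj_on f (dom f)" and g: "inj_on g (dom g)"
  shows "inj_on (f \<circ>\<^sub>m g) (dom (f \<circ>\<^sub>m g))"
proof (rule inj_onI)
  fix x y assume "x \<in> dom (f \<circ>\<^sub>m g)" and eq: "(f \<circ>\<^sub>m g) x = (f \<circ>\<^sub>m g) y"
  then obtain z where "(f \<circ>\<^sub>m g) x = Some z" "(f \<circ>\<^sub>m g) y = Some z"
    by (metis domD)
  then obtain u v where uv: "g x = Some u" "f u = Some z" "g y = Some v" "f v = Some z"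
    by (auto simp: map_comp_Some_iff)
  then have "u = v" using f by (metis domI inj_onD)
  then show "x = y" using g uv by (metis domI inj_onD)
qed

lemma partial_inverse_map_comp:
  assumes f: "inj_on f (dom f)" and g: "inj_on g (dom g)"
  shows "partial_inverse (f \<circ>\<^sub>m g) = partial_inverse g \<circ>\<^sub>m partial_inverse f"
proof
  fix z
  have "partial_inverse (f \<circ>\<^sub>m g) z = Some x \<longleftrightarrow> (partial_inverse g \<circ>\<^sub>m partial_inverse f) z = Some x" for x
    unfolding partial_inverse_eq_Some_iff[OF inj_on_map_comp[OF f g]] map_comp_Some_iff
    by (auto simp: partial_inverse_eq_Some_iff[OF f] partial_inverse_eq_Some_iff[OF g])
  then show "partial_inverse (f \<circ>\<^sub>m g) z = (partial_inverse g \<circ>\<^sub>m partial_inverse f) z"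
    by (metis option.exhaust)
qed

text \<open>This description is symmetric in \<open>f\<close> and its inverse, and preimages compose, so closure of
  \<^term>\<open>partial_homeos X\<close> under inversion and composition can be read off from it.\<close>

lemma partial_homeos_iff:
  "f \<in> partial_homeos X \<longleftrightarrow>
     inj_on f (dom f) \<and> dom f \<subseteq> topspace X \<and> ran f \<subseteq> topspace X \<and>
     (\<forall>V. openin X V \<longrightarrow>
        openin X (partial_preimage f V) \<and> openin X (partial_preimage (partial_inverse f) V))"
  (is "?L \<longleftrightarrow> ?R")
proof -
  let ?h = "\<lambda>x. the (f x)"
  have inj: "inj_on ?h (dom f) \<longleftrightarrow> inj_on f (dom f)"
    by (auto simp: inj_on_def dom_def)
  have im: "?h ` dom f = ran f"
    by (force simp: dom_def ran_def image_iff)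
  have pre: "partial_preimage f V = {x \<in> dom f. ?h x \<in> V}" for V
    by (auto simp: partial_preimage_def)
  have ipre: "partial_preimage (partial_inverse f) V = ?h ` (dom f \<inter> V)" if "inj_on f (dom f)" for V
    by (force simp: partial_preimage_def partial_inverse_eq_Some_iff[OF that] image_iff)
  show ?thesis
  proof
    assume L: ?L
    then have d: "openin X (dom f)" and r: "openin X (ran f)"
      and h: "homeomorphic_map (subtopology X (dom f)) (subtopology X (ran f)) ?h"
      by (auto simp: partial_homeos_def)
    have ts: "topspace (subtopology X (dom f)) = dom f" "topspace (subtopology X (ran f)) = ran f"
      using d r by (auto dest: openin_subset)
    have ij: "inj_on f (dom f)"
      using h inj ts by (simp add: homeomorphic_eq_everything_map)
    have "openin X (partial_preimage f V)" if V: "openin X V" for V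
    proof -
      have "openin (subtopology X (dom f)) {x \<in> topspace (subtopology X (dom f)). ?h x \<in> V}"
        using h V
        by (intro openin_continuous_map_preimage[of _ X])
          (auto simp: homeomorphic_eq_everything_map continuous_map_in_subtopology)
      then show ?thesis
        using d unfolding ts pre by (simp add: openin_open_subtopology)
    qed
    moreover have "openin X (partial_preimage (partial_inverse f) V)" if V: "openin X V" for V
    proof -
      have "openin (subtopology X (dom f)) (dom f \<inter> V)"
        using V d by (simp add: openin_open_subtopology openin_Int)
      then have "openin (subtopology X (ran f)) (?h ` (dom f \<inter> V))"
        using h by (simp add: homeomorphic_eq_everything_map open_map_def)
      then show ?thesis
        using r unfolding ipre[OF ij] by (simp add: openin_open_subtopology)
    qed
    ultimately show ?R
      using ij openin_subset[OF d] openin_subset[OF r] by blast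
  next
    assume R: ?R
    then have ij: "inj_on f (dom f)" by blast
    have "dom f = partial_preimage f (topspace X)"
      using R by (auto simp: partial_preimage_def ran_def dom_def)
    then have d: "openin X (dom f)" using R by (metis openin_topspace)
    have "ran f = partial_preimage (partial_inverse f) (topspace X)"
      using R by (auto simp: partial_preimage_def partial_inverse_eq_Some_iff ran_def dom_def)
    then have r: "openin X (ran f)" using R by (metis openin_topspace)
    have ts: "topspace (subtopology X (dom f)) = dom f" "topspace (subtopology X (ran f)) = ran f"
      using d r by (auto dest: openin_subset)
    have "continuous_map (subtopology X (dom f)) (subtopology X (ran f)) ?h"
      unfolding continuous_map ts
    proof (intro conjI allI impI)
      fix U assume "openin (subtopology X (ran f)) U"
      then have "openin X {x \<in> dom f. ?h x \<in> U}"
        using R r unfolding pre by (simp add: openin_open_subtopology)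
      then show "openin (subtopology X (dom f)) {x \<in> dom f. ?h x \<in> U}"
        using d by (auto simp: openin_open_subtopology)
    qed (use im in auto)
    moreover have "open_map (subtopology X (dom f)) (subtopology X (ran f)) ?h"
      unfolding open_map_def
    proof (intro allI impI)
      fix U assume "openin (subtopology X (dom f)) U"
      then have U: "openin X U" "dom f \<inter> U = U"
        using d by (auto simp: openin_open_subtopology)
      then have "openin X (?h ` U)" using R ipre[OF ij, of U] by metis
      then show "openin (subtopology X (ran f)) (?h ` U)"
        using r U im by (auto simp: openin_open_subtopology)
    qed
    ultimately have "homeomorphic_map (subtopology X (dom f)) (subtopology X (ran f)) ?h"
      using im inj ij ts by (intro bijective_open_imp_homeomorphic_map) auto
    then show ?L using d r by (simp add: partial_homeos_def)
  qed
qed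

lemma partial_homeos_inj: "f \<in> partial_homeos X \<Longrightarrow> inj_on f (dom f)"
  by (simp add: partial_homeos_iff)

lemma openin_dom: "f \<in> partial_homeos X \<Longrightarrow> openin X (dom f)"
  by (simp add: partial_homeos_def)

lemma openin_partial_preimage:
  "f \<in> partial_homeos X \<Longrightarrow> openin X V \<Longrightarrow> openin X (partial_preimage f V)"
  by (simp add: partial_homeos_iff)

lemma partial_preimage_topspace:
  "f \<in> partial_homeos X \<Longrightarrow> partial_preimage f (topspace X) = dom f"
  by (force simp: partial_homeos_iff partial_preimage_def ran_def dom_def)

lemma partial_homeos_inverse:
  assumes "f \<in> partial_homeos X"
  shows "partial_inverse f \<in> partial_homeos X"
proof -
  have "ran (partial_inverse f) = dom f"
    using dom_partial_inverse[of "partial_inverse f"]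
      partial_inverse_partial_inverse[OF partial_homeos_inj[OF assms]] by simp
  then show ?thesis
    using assms inj_on_partial_inverse[of f]
    by (simp add: partial_homeos_iff partial_inverse_partial_inverse)
qed

lemma partial_homeos_comp:
  assumes f: "f \<in> partial_homeos X" and g: "g \<in> partial_homeos X"
  shows "f \<circ>\<^sub>m g \<in> partial_homeos X"
proof -
  have "dom (f \<circ>\<^sub>m g) \<subseteq> dom g" "ran (f \<circ>\<^sub>m g) \<subseteq> ran f"
    by (auto simp: ran_def map_comp_Some_iff)
  moreover have "dom g \<subseteq> topspace X" "ran f \<subseteq> topspace X"
    using f g by (simp_all add: partial_homeos_iff)
  ultimately have "dom (f \<circ>\<^sub>m g) \<subseteq> topspace X" "ran (f \<circ>\<^sub>m g) \<subseteq> topspace X"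
    by (meson order_trans)+
  then show ?thesis
    using f g inj_on_map_comp[of f g]
    by (simp add: partial_homeos_iff partial_inverse_map_comp partial_preimage_map_comp)
qed

lemma partial_inverse_involution:
  "f \<in> partial_homeos X \<Longrightarrow> partial_inverse (partial_inverse f) = f"
  by (simp add: partial_homeos_inj partial_inverse_partial_inverse)

lemma restricted_identity_in_partial_homeos:
  assumes "openin X V"
  shows "Some |` V \<in> partial_homeos X"
proof -
  have inj: "inj_on (Some |` V) (dom (Some |` V))"
    by (auto simp: inj_on_def restrict_map_def)
  have eq: "(Some |` V) x = Some y \<longleftrightarrow> y = x \<and> x \<in> V" for x y
    by (auto simp: restrict_map_def)
  have "partial_preimage (Some |` V) W = W \<inter> V"
    "partial_preimage (partial_inverse (Some |` V)) W = W \<inter> V" for W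
    by (auto simp: partial_preimage_def partial_inverse_eq_Some_iff[OF inj] eq)
  then show ?thesis
    using assms inj openin_subset[OF assms]
    by (auto simp: partial_homeos_iff ran_def eq)
qed

text \<open>Preimages under \<^term>\<open>partial_inverse f\<close> are images under \<open>f\<close>; the condition
  \<^term>\<open>K \<subseteq> dom f\<close> puts \<open>K\<close> into the subspace on which \<open>f\<close> is continuous.\<close>

lemma compactin_partial_image:
  assumes f: "f \<in> partial_homeos X" and K: "compactin X K" "K \<subseteq> dom f"
  shows "compactin X (partial_preimage (partial_inverse f) K)"
proof -
  have "continuous_map (subtopology X (dom f)) X (\<lambda>x. the (f x))"
    using f by (auto simp: partial_homeos_def homeomorphic_eq_everything_map
        continuous_map_in_subtopology)
  then have "compactin X ((\<lambda>x. the (f x)) ` K)"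
    using K by (intro image_compactin[of "subtopology X (dom f)"]) (auto simp: compactin_subtopology)
  also have "(\<lambda>x. the (f x)) ` K = partial_preimage (partial_inverse f) K"
    using K by (force simp: partial_preimage_def partial_inverse_eq_Some_iff partial_homeos_inj[OF f]
        image_iff)
  finally show ?thesis .
qed

lemma partial_inverse_generalized_inverse:
  assumes "inj_on f (dom f)"
  shows "(f \<circ>\<^sub>m partial_inverse f) \<circ>\<^sub>m f = f"
proof
  fix x
  show "((f \<circ>\<^sub>m partial_inverse f) \<circ>\<^sub>m f) x = f x"
  proof (cases "f x")
    case (Some y)
    then have "partial_inverse f y = Some x" using assms by (simp add: partial_inverse_eq_Some_iff)
    then show ?thesis using Some by simp
  qed simp
qed

text \<open>From \<open>f g f = f\<close> and injectivity of \<open>f\<close>, \<open>g\<close> undoes \<open>f\<close> on its whole domain; by symmetry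
  \<open>f\<close> undoes \<open>g\<close>. Together these say that the graphs are converse to each other.\<close>

lemma generalized_inverse_unique:
  assumes f: "inj_on f (dom f)" and g: "inj_on g (dom g)"
    and fgf: "(f \<circ>\<^sub>m g) \<circ>\<^sub>m f = f" and gfg: "(g \<circ>\<^sub>m f) \<circ>\<^sub>m g = g"
  shows "g = partial_inverse f"
proof -
  have undo: "b y = Some x"
    if a: "inj_on a (dom a)" and aba: "(a \<circ>\<^sub>m b) \<circ>\<^sub>m a = a" and xy: "a x = Some y" for a b :: "'a \<rightharpoonup> 'a" and x y
  proof -
    have "((a \<circ>\<^sub>m b) \<circ>\<^sub>m a) x = Some y" using aba xy by simp
    then obtain z where "b y = Some z" "a z = Some y" using xy by (auto simp: map_comp_Some_iff)
    then show ?thesis using a xy by (metis domI inj_onD)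
  qed
  have "g y = Some x \<longleftrightarrow> partial_inverse f y = Some x" for x y
    unfolding partial_inverse_eq_Some_iff[OF f]
    using undo[OF f fgf] undo[OF g gfg] by blast
  then show ?thesis by (metis ext option.exhaust)
qed

text \<open>Existence and uniqueness in one equivalence: it yields both the inverse semigroup axiom
  and the value of the definite description in \<^const>\<open>semigroup_inverse\<close>.\<close>

lemma partial_homeo_inverse_characterization:
  assumes f: "f \<in> partial_homeos X"
  shows "g \<in> partial_homeos X \<and> (f \<circ>\<^sub>m g) \<circ>\<^sub>m f = f \<and> (g \<circ>\<^sub>m f) \<circ>\<^sub>m g = g \<longleftrightarrow> g = partial_inverse f"
proof
  assume "g \<in> partial_homeos X \<and> (f \<circ>\<^sub>m g) \<circ>\<^sub>m f = f \<and> (g \<circ>\<^sub>m f) \<circ>\<^sub>m g = g"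
  then show "g = partial_inverse f"
    using f by (intro generalized_inverse_unique) (auto intro: partial_homeos_inj)
next
  assume g: "g = partial_inverse f"
  have "(partial_inverse f \<circ>\<^sub>m f) \<circ>\<^sub>m partial_inverse f = partial_inverse f"
    using partial_inverse_generalized_inverse[OF partial_homeos_inj[OF partial_homeos_inverse[OF f]]]
    by (simp add: partial_inverse_involution[OF f])
  then show "g \<in> partial_homeos X \<and> (f \<circ>\<^sub>m g) \<circ>\<^sub>m f = f \<and> (g \<circ>\<^sub>m f) \<circ>\<^sub>m g = g"
    unfolding g using f
    by (simp add: partial_homeos_inverse partial_inverse_generalized_inverse partial_homeos_inj)
qed

lemma inverse_semigroup_partial_homeos: "inverse_semigroup_on (partial_homeos X) (\<circ>\<^sub>m)"
proof -
  have "(f \<circ>\<^sub>m g) \<circ>\<^sub>m h = f \<circ>\<^sub>m (g \<circ>\<^sub>m h)" for f g h :: "'a \<rightharpoonup> 'a"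
    by (auto simp: map_comp_def split: option.splits)
  moreover have "\<exists>!g. g \<in> partial_homeos X \<and> (f \<circ>\<^sub>m g) \<circ>\<^sub>m f = f \<and> (g \<circ>\<^sub>m f) \<circ>\<^sub>m g = g"
    if "f \<in> partial_homeos X" for f
    unfolding partial_homeo_inverse_characterization[OF that] by simp
  ultimately show ?thesis
    unfolding inverse_semigroup_on_def using partial_homeos_comp[of _ X] by blast
qed

lemma semigroup_inverse_partial_homeos:
  "f \<in> partial_homeos X \<Longrightarrow> semigroup_inverse (partial_homeos X) (\<circ>\<^sub>m) f = partial_inverse f"
  unfolding semigroup_inverse_def by (simp add: partial_homeo_inverse_characterization)

section \<open>A subbasis closed under inversion\<close>

definition domain_misses_set :: "'a topology \<Rightarrow> 'a set \<Rightarrow> ('a \<rightharpoonup> 'a) set" where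
  "domain_misses_set X V = {f \<in> partial_homeos X. \<not> V \<subseteq> dom f}"

definition inverted_set :: "'a topology \<Rightarrow> ('a \<rightharpoonup> 'a) set \<Rightarrow> ('a \<rightharpoonup> 'a) set" where
  "inverted_set X S = {f \<in> partial_homeos X. partial_inverse f \<in> S}"

definition domain_subbasis :: "'a topology \<Rightarrow> ('a \<rightharpoonup> 'a) set set" where
  "domain_subbasis X = {compact_open_set X K V | K V. compactin X K \<and> openin X V} \<union>
     {domain_misses_set X V | V. openin X V}"

text \<open>Only conditions on domains are listed in \<^const>\<open>domain_subbasis\<close>; conditions on images are
  conditions on the domain of the inverse. This makes closure under inversion hold by construction.\<close>

definition hco_subbasis :: "'a topology \<Rightarrow> ('a \<rightharpoonup> 'a) set set" where
  "hco_subbasis X = domain_subbasis X \<union> inverted_set X ` domain_subbasis X"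

lemma compact_open_set_iff:
  "f \<in> compact_open_set X K V \<longleftrightarrow> f \<in> partial_homeos X \<and> K \<subseteq> partial_preimage f V"
  by (force simp: compact_open_set_def partial_preimage_def)

lemma inv_compact_open_set_eq:
  "inv_compact_open_set X K V = inverted_set X (compact_open_set X K V)"
  by (simp add: inv_compact_open_set_def inverted_set_def)

lemma domain_subbasis_subset: "S \<in> domain_subbasis X \<Longrightarrow> S \<subseteq> partial_homeos X"
  by (auto simp: domain_subbasis_def compact_open_set_def domain_misses_set_def)

lemma inverted_set_inverted_set:
  "S \<subseteq> partial_homeos X \<Longrightarrow> inverted_set X (inverted_set X S) = S"
  by (auto simp: inverted_set_def partial_inverse_involution partial_homeos_inverse)

lemma Union_hco_subbasis: "\<Union>(hco_subbasis X) = partial_homeos X"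
proof
  show "\<Union>(hco_subbasis X) \<subseteq> partial_homeos X"
    using domain_subbasis_subset[of _ X] unfolding hco_subbasis_def inverted_set_def by blast
  have "compactin X {}" "openin X {}" by auto
  then have "compact_open_set X {} {} \<in> hco_subbasis X"
    unfolding hco_subbasis_def domain_subbasis_def by blast
  moreover have "compact_open_set X {} {} = partial_homeos X"
    by (simp add: compact_open_set_def)
  ultimately show "partial_homeos X \<subseteq> \<Union>(hco_subbasis X)" by blast
qed

lemma openin_generated_minimal:
  assumes "\<And>S. S \<in> \<S> \<Longrightarrow> openin T S" and "openin (topology_generated_by \<S>) U"
  shows "openin T U"
  using generate_topology_on_coarsest[OF istopology_openin assms(1) openin_topology_generated_by[OF assms(2)]] .

text \<open>Inversion is an involution, so it permutes the subbasic sets.\<close>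

lemma inversion_continuous_hco_subbasis:
  "continuous_map (topology_generated_by (hco_subbasis X)) (topology_generated_by (hco_subbasis X))
     partial_inverse" (is "continuous_map ?T _ _")
proof (rule continuous_on_generated_topo)
  fix U assume U: "U \<in> hco_subbasis X"
  have "partial_inverse -` U \<inter> topspace ?T = inverted_set X U"
    by (auto simp: Union_hco_subbasis inverted_set_def)
  moreover have "inverted_set X U \<in> hco_subbasis X"
    using U domain_subbasis_subset
    by (fastforce simp: hco_subbasis_def inverted_set_inverted_set)
  ultimately show "openin ?T (partial_inverse -` U \<inter> topspace ?T)"
    by (simp add: topology_generated_by_Basis)
qed (auto simp: Union_hco_subbasis partial_homeos_inverse)

text \<open>The preimage of a Fell hit set is a set \<^const>\<open>domain_misses_set\<close>. For a Fell miss set, given by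
  \<open>W\<close> with compact complement, it is the compact-open set of all maps defined on that complement.\<close>

lemma dom_compl_continuous_fell:
  "continuous_map (topology_generated_by (hco_subbasis X)) (fell_topology X) (dom_compl X)"
  (is "continuous_map ?T _ _")
  unfolding fell_topology_def
proof (rule continuous_on_generated_topo)
  let ?F = "{{A. closedin X A \<and> A \<inter> V \<noteq> {}} | V. openin X V} \<union>
      {{A. closedin X A \<and> A \<subseteq> W} | W. openin X W \<and> compactin X (topspace X - W)}"
  have closed: "closedin X (dom_compl X f)" if "f \<in> partial_homeos X" for f
    using openin_dom[OF that] by (auto simp: dom_compl_def)
  fix U assume "U \<in> ?F"
  then consider (hit) V where "openin X V" "U = {A. closedin X A \<and> A \<inter> V \<noteq> {}}"
    | (inside) W where "openin X W" "compactin X (topspace X - W)" "U = {A. closedin X A \<and> A \<subseteq> W}"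
    by auto
  then show "openin ?T (dom_compl X -` U \<inter> topspace ?T)"
  proof cases
    case hit
    then have "dom_compl X -` U \<inter> topspace ?T = domain_misses_set X V"
      using closed openin_subset[OF hit(1)]
      by (auto simp: Union_hco_subbasis domain_misses_set_def dom_compl_def)
    moreover have "domain_misses_set X V \<in> hco_subbasis X"
      using hit by (auto simp: hco_subbasis_def domain_subbasis_def)
    ultimately show ?thesis by (simp add: topology_generated_by_Basis)
  next
    case inside
    then have "dom_compl X -` U \<inter> topspace ?T
        = compact_open_set X (topspace X - W) (topspace X)"
      using closed
      by (force simp: Union_hco_subbasis compact_open_set_iff partial_preimage_topspace dom_compl_def)
    moreover have "compact_open_set X (topspace X - W) (topspace X) \<in> hco_subbasis X"
      using inside unfolding hco_subbasis_def domain_subbasis_def by blast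
    ultimately show ?thesis by (simp add: topology_generated_by_Basis)
  qed
next
  \<comment> \<open>The Fell miss set for \<^term>\<open>W = topspace X\<close>, whose complement is empty, contains every value.\<close>
  have "dom_compl X f \<in> {A. closedin X A \<and> A \<subseteq> topspace X}" if "f \<in> partial_homeos X" for f
    using openin_dom[OF that] by (auto simp: dom_compl_def)
  moreover have "openin X (topspace X) \<and> compactin X (topspace X - topspace X)" by simp
  ultimately show "dom_compl X ` topspace ?T \<subseteq> \<Union> ({{A. closedin X A \<and> A \<inter> V \<noteq> {}} | V. openin X V} \<union>
      {{A. closedin X A \<and> A \<subseteq> W} | W. openin X W \<and> compactin X (topspace X - W)})"
    unfolding topology_generated_by_topspace Union_hco_subbasis by blast
qed

lemma im_compl_continuous_fell:
  "continuous_map (topology_generated_by (hco_subbasis X)) (fell_topology X) (im_compl X)"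
proof -
  have "im_compl X = dom_compl X \<circ> partial_inverse"
    by (auto simp: im_compl_def dom_compl_def)
  then show ?thesis
    using continuous_map_compose[OF inversion_continuous_hco_subbasis dom_compl_continuous_fell] by metis
qed

proposition tau_hco_eq: "tau_hco X = topology_generated_by (hco_subbasis X)"
proof -
  let ?T = "topology_generated_by (hco_subbasis X)"
  have ico: "openin ?T U" if "openin (tau_ico X) U" for U
  proof (rule openin_generated_minimal[OF _ that[unfolded tau_ico_def]])
    fix S assume "S \<in> {compact_open_set X K V |K V. compactin X K \<and> openin X V} \<union>
      {inv_compact_open_set X K V |K V. compactin X K \<and> openin X V}"
    then have "S \<in> hco_subbasis X"
      unfolding hco_subbasis_def domain_subbasis_def inv_compact_open_set_eq by blast
    then show "openin ?T S" by (rule topology_generated_by_Basis)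
  qed
  have ts: "topspace ?T = partial_homeos X" by (simp add: Union_hco_subbasis)
  have "openin ?T {f \<in> partial_homeos X. dom_compl X f \<in> U}"
    "openin ?T {f \<in> partial_homeos X. im_compl X f \<in> U}" if "openin (fell_topology X) U" for U
    using openin_continuous_map_preimage[OF dom_compl_continuous_fell that]
      openin_continuous_map_preimage[OF im_compl_continuous_fell that] unfolding ts by blast+
  then have "openin ?T U" if "openin (tau_hco X) U" for U
    using that ico unfolding tau_hco_def by (elim openin_generated_minimal[rotated]) blast
  moreover have "openin (tau_hco X) U" if "openin ?T U" for U
  proof (rule openin_generated_minimal[OF _ that])
    have hit: "openin (fell_topology X) {A. closedin X A \<and> A \<inter> V \<noteq> {}}" if "openin X V" for V
      unfolding fell_topology_def using that by (intro topology_generated_by_Basis) blast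
    have ico: "openin (tau_hco X) U" if "openin (tau_ico X) U" for U
      unfolding tau_hco_def using that by (intro topology_generated_by_Basis) blast
    have D: "openin (tau_hco X) {f \<in> partial_homeos X. dom_compl X f \<in> U}"
      and I: "openin (tau_hco X) {f \<in> partial_homeos X. im_compl X f \<in> U}"
      if "openin (fell_topology X) U" for U
      unfolding tau_hco_def using that by (auto intro!: topology_generated_by_Basis)
    have dm: "domain_misses_set X V =
        {f \<in> partial_homeos X. dom_compl X f \<in> {A. closedin X A \<and> A \<inter> V \<noteq> {}}}" if "openin X V" for V
      using openin_subset[OF that] openin_dom[of _ X]
      by (auto simp: domain_misses_set_def dom_compl_def)
    have im: "im_compl X f = dom_compl X (partial_inverse f)" for f
      by (simp add: im_compl_def dom_compl_def)
    have idm: "inverted_set X (domain_misses_set X V) =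
        {f \<in> partial_homeos X. im_compl X f \<in> {A. closedin X A \<and> A \<inter> V \<noteq> {}}}" if "openin X V" for V
      unfolding im dm[OF that] inverted_set_def by (auto simp: partial_homeos_inverse)
    fix S assume "S \<in> hco_subbasis X"
    then consider (co) K V where "compactin X K" "openin X V" "S = compact_open_set X K V"
      | (inv_co) K V where "compactin X K" "openin X V" "S = inv_compact_open_set X K V"
      | (miss) V where "openin X V" "S = domain_misses_set X V"
      | (inv_miss) V where "openin X V" "S = inverted_set X (domain_misses_set X V)"
      unfolding hco_subbasis_def domain_subbasis_def inv_compact_open_set_eq by blast
    then show "openin (tau_hco X) S"
    proof cases
      case co
      then show ?thesis
        by (intro ico) (auto simp: tau_ico_def intro!: topology_generated_by_Basis)
    next
      case inv_co
      then show ?thesis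
        by (intro ico) (auto simp: tau_ico_def intro!: topology_generated_by_Basis)
    next
      case miss
      then show ?thesis using D[OF hit] dm by simp
    next
      case inv_miss
      then show ?thesis using I[OF hit] idm by simp
    qed
  qed
  ultimately show ?thesis by (auto simp: topology_eq)
qed

lemma topspace_tau_hco: "topspace (tau_hco X) = partial_homeos X"
  by (simp add: tau_hco_eq Union_hco_subbasis)

lemma openin_tau_hco_compact_open:
  "compactin X K \<Longrightarrow> openin X V \<Longrightarrow> openin (tau_hco X) (compact_open_set X K V)"
  unfolding tau_hco_eq hco_subbasis_def domain_subbasis_def
  by (intro topology_generated_by_Basis) blast

lemma openin_tau_hco_domain_misses:
  "openin X V \<Longrightarrow> openin (tau_hco X) (domain_misses_set X V)"
  unfolding tau_hco_eq hco_subbasis_def domain_subbasis_def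
  by (intro topology_generated_by_Basis) blast

lemma continuous_map_partial_inverse_tau_hco:
  "continuous_map (tau_hco X) (tau_hco X) partial_inverse"
  unfolding tau_hco_eq by (rule inversion_continuous_hco_subbasis)

lemma openin_tau_hco_inverted:
  assumes "openin (tau_hco X) S"
  shows "openin (tau_hco X) (inverted_set X S)"
  using openin_continuous_map_preimage[OF continuous_map_partial_inverse_tau_hco assms]
  by (simp add: inverted_set_def topspace_tau_hco)

section \<open>Admissibility\<close>

text \<open>The open subspace \<open>W\<close> is again locally compact and Hausdorff, so the compact neighbourhood of
  \<open>K\<close> can be taken inside it.\<close>

lemma compact_neighbourhood_between:
  assumes "locally_compact_space X" "Hausdorff_space X" and K: "compactin X K" and W: "openin X W" "K \<subseteq> W"
  obtains U C where "openin X U" "compactin X C" "K \<subseteq> U" "U \<subseteq> C" "C \<subseteq> W"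
proof -
  have "locally_compact_space (subtopology X W)" "Hausdorff_space (subtopology X W)"
    using assms locally_compact_Hausdorff_imp_regular_space
    by (auto simp: Hausdorff_space_subtopology intro!: locally_compact_space_open_subset)
  moreover have "compactin (subtopology X W) K" using K W by (simp add: compactin_subtopology)
  ultimately obtain U C where "openin (subtopology X W) U" "compactin (subtopology X W) C" "K \<subseteq> U" "U \<subseteq> C"
    using locally_compact_space_compact_closed_compact[of "subtopology X W"] by blast
  then show ?thesis
    using that W by (auto simp: openin_open_subtopology compactin_subtopology)
qed

text \<open>If \<open>x\<close> lies in \<open>dom f\<close> but not in \<open>dom g\<close>, choose \<open>x \<in> U \<subseteq> C \<subseteq> dom f\<close> with \<open>U\<close> open and
  \<open>C\<close> compact: being defined on all of \<open>C\<close> excludes missing a point of \<open>U\<close>. If the domains agree,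
  two different values at one point are separated in \<open>X\<close>.\<close>

lemma Hausdorff_tau_hco:
  assumes lc: "locally_compact_space X" and H: "Hausdorff_space X"
  shows "Hausdorff_space (tau_hco X)"
proof -
  let ?sep = "\<lambda>f g. \<exists>U V. openin (tau_hco X) U \<and> openin (tau_hco X) V \<and> f \<in> U \<and> g \<in> V \<and> disjnt U V"
  have dom: "?sep f g" if f: "f \<in> partial_homeos X" and g: "g \<in> partial_homeos X"
    and x: "x \<in> dom f" "x \<notin> dom g" for f g x
  proof -
    have "x \<in> topspace X" using x openin_subset[OF openin_dom[OF f]] by blast
    then obtain U C where UC: "openin X U" "compactin X C" "x \<in> U" "U \<subseteq> C" "C \<subseteq> dom f"
      using compact_neighbourhood_between[OF lc H, of "{x}" "dom f"] x openin_dom[OF f] by auto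
    have "f \<in> compact_open_set X C (topspace X)"
      using f UC by (simp add: compact_open_set_iff partial_preimage_topspace)
    moreover have "g \<in> domain_misses_set X U"
      using g UC x by (auto simp: domain_misses_set_def)
    moreover have "disjnt (compact_open_set X C (topspace X)) (domain_misses_set X U)"
      using UC by (auto simp: disjnt_iff compact_open_set_iff domain_misses_set_def partial_preimage_topspace)
    ultimately show ?thesis
      using openin_tau_hco_compact_open[OF UC(2) openin_topspace] openin_tau_hco_domain_misses[OF UC(1)]
      by blast
  qed
  have val: "?sep f g" if f: "f \<in> partial_homeos X" and g: "g \<in> partial_homeos X"
    and x: "f x = Some y" "g x = Some z" "y \<noteq> z" for f g x y z
  proof -
    have "y \<in> topspace X" "z \<in> topspace X" "x \<in> topspace X"
      using f g x by (auto simp: partial_homeos_iff intro: ranI)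
    then obtain U V where UV: "openin X U" "openin X V" "y \<in> U" "z \<in> V" "disjnt U V"
      using H x unfolding Hausdorff_space_def by blast
    have "compactin X {x}" using \<open>x \<in> topspace X\<close> by simp
    moreover have "f \<in> compact_open_set X {x} U" "g \<in> compact_open_set X {x} V"
      using f g x UV by (auto simp: compact_open_set_def)
    moreover have "disjnt (compact_open_set X {x} U) (compact_open_set X {x} V)"
      using UV by (auto simp: disjnt_iff compact_open_set_def)
    ultimately show ?thesis
      using openin_tau_hco_compact_open UV(1,2) by metis
  qed
  show ?thesis
    unfolding Hausdorff_space_def topspace_tau_hco
  proof (intro allI impI)
    fix f g assume fg: "f \<in> partial_homeos X \<and> g \<in> partial_homeos X \<and> f \<noteq> g"
    then obtain x where x: "f x \<noteq> g x" by auto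
    consider "x \<in> dom f" "x \<notin> dom g" | "x \<in> dom g" "x \<notin> dom f" |
      y z where "f x = Some y" "g x = Some z" "y \<noteq> z"
      using x by (cases "f x"; cases "g x") auto
    then show "?sep f g"
    proof cases
      case 1
      then show ?thesis using dom fg by simp
    next
      case 2
      then have "?sep g f" using dom fg by simp
      then show ?thesis by (metis disjnt_sym)
    next
      case (3 y z)
      then show ?thesis using val[of f g x y z] fg by simp
    qed
  qed
qed

text \<open>The image \<open>g(K)\<close> is compact and lies in the open set \<open>f\<^sup>-\<^sup>1(V)\<close>. With
  \<open>g(K) \<subseteq> U \<subseteq> C \<subseteq> f\<^sup>-\<^sup>1(V)\<close>, the neighbourhoods \<open>\<langle>C;V\<rangle>\<close> of \<open>f\<close> and \<open>\<langle>K;U\<rangle>\<close> of \<open>g\<close> work.\<close>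

lemma multiplication_nbhd_compact_open:
  assumes lc: "locally_compact_space X" and H: "Hausdorff_space X"
    and f: "f \<in> partial_homeos X" and g: "g \<in> partial_homeos X"
    and K: "compactin X K" and V: "openin X V" and fg: "f \<circ>\<^sub>m g \<in> compact_open_set X K V"
  obtains A B where "openin (tau_hco X) A" "openin (tau_hco X) B" "f \<in> A" "g \<in> B"
    "\<And>a b. a \<in> A \<Longrightarrow> b \<in> B \<Longrightarrow> a \<circ>\<^sub>m b \<in> compact_open_set X K V"
proof -
  let ?L = "partial_preimage (partial_inverse g) K"
  have sub: "K \<subseteq> partial_preimage g (partial_preimage f V)"
    using fg by (simp add: compact_open_set_iff partial_preimage_map_comp)
  then have "K \<subseteq> dom g" by (auto simp: partial_preimage_def)
  then have "compactin X ?L" using compactin_partial_image[OF g K] by blast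
  moreover have "?L \<subseteq> partial_preimage f V"
    using sub by (fastforce simp: partial_preimage_def partial_inverse_eq_Some_iff[OF partial_homeos_inj[OF g]])
  ultimately obtain U C where UC: "openin X U" "compactin X C" "?L \<subseteq> U" "U \<subseteq> C" "C \<subseteq> partial_preimage f V"
    using compact_neighbourhood_between[OF lc H _ openin_partial_preimage[OF f V]] by metis
  have "K \<subseteq> partial_preimage g U"
    using sub UC(3) by (fastforce simp: partial_preimage_def partial_inverse_eq_Some_iff[OF partial_homeos_inj[OF g]])
  show ?thesis
  proof (rule that[of "compact_open_set X C V" "compact_open_set X K U"])
    show "f \<in> compact_open_set X C V" using f UC by (simp add: compact_open_set_iff)
    show "g \<in> compact_open_set X K U"
      using g \<open>K \<subseteq> partial_preimage g U\<close> by (simp add: compact_open_set_iff)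
    fix a b assume ab: "a \<in> compact_open_set X C V" "b \<in> compact_open_set X K U"
    then have "K \<subseteq> partial_preimage b (partial_preimage a V)"
      using UC(4) by (fastforce simp: compact_open_set_iff partial_preimage_def)
    then show "a \<circ>\<^sub>m b \<in> compact_open_set X K V"
      using ab by (simp add: compact_open_set_iff partial_preimage_map_comp partial_homeos_comp)
  qed (use UC K V in \<open>auto intro: openin_tau_hco_compact_open\<close>)
qed

text \<open>If the composite is undefined at \<open>x\<close> because \<open>g\<close> is, then any left factor will do. If \<open>g x = y\<close>
  and \<open>f\<close> is undefined at \<open>y\<close>, choose \<open>y \<in> U \<subseteq> C \<subseteq> g(V)\<close>. A map \<open>a\<close> near \<open>f\<close> misses some
  \<open>z \<in> U\<close>, and a map \<open>b\<close> near \<open>g\<close> satisfies \<open>b\<^sup>-\<^sup>1(C) \<subseteq> V\<close> with \<open>b\<^sup>-\<^sup>1\<close> defined on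
  \<open>C\<close>; so \<open>b\<^sup>-\<^sup>1 z\<close> is a point of \<open>V\<close> at which \<open>a b\<close> is undefined. Here it matters that the
  topology also controls the inverses.\<close>

lemma multiplication_nbhd_domain_misses:
  assumes lc: "locally_compact_space X" and H: "Hausdorff_space X"
    and f: "f \<in> partial_homeos X" and g: "g \<in> partial_homeos X"
    and V: "openin X V" and fg: "f \<circ>\<^sub>m g \<in> domain_misses_set X V"
  obtains A B where "openin (tau_hco X) A" "openin (tau_hco X) B" "f \<in> A" "g \<in> B"
    "\<And>a b. a \<in> A \<Longrightarrow> b \<in> B \<Longrightarrow> a \<circ>\<^sub>m b \<in> domain_misses_set X V"
proof -
  obtain x where x: "x \<in> V" "(f \<circ>\<^sub>m g) x = None"
    using fg by (auto simp: domain_misses_set_def)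
  show ?thesis
  proof (cases "g x")
    case None
    have "a \<circ>\<^sub>m b \<in> domain_misses_set X V" if "a \<in> partial_homeos X" "b \<in> domain_misses_set X V" for a b
      using that by (auto simp: domain_misses_set_def partial_homeos_comp)
    moreover have "g \<in> domain_misses_set X V"
      using g None x by (auto simp: domain_misses_set_def)
    ultimately show ?thesis
      using that[of "partial_homeos X" "domain_misses_set X V"] f openin_tau_hco_domain_misses[OF V]
      by (metis openin_topspace topspace_tau_hco)
  next
    case (Some y)
    then have fy: "y \<notin> dom f" using x by auto
    let ?i = "partial_inverse g"
    have i: "?i \<in> partial_homeos X" using g by (rule partial_homeos_inverse)
    have y: "y \<in> partial_preimage ?i V"
      using Some x by (auto simp: partial_preimage_def partial_inverse_eq_Some_iff[OF partial_homeos_inj[OF g]])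
    have "y \<in> topspace X" using Some g by (auto simp: partial_homeos_iff intro: ranI)
    then obtain U C where UC: "openin X U" "compactin X C" "y \<in> U" "U \<subseteq> C" "C \<subseteq> partial_preimage ?i V"
      using compact_neighbourhood_between[OF lc H _ openin_partial_preimage[OF i V], of "{y}"] y by auto
    show ?thesis
    proof (rule that[of "domain_misses_set X U" "inverted_set X (compact_open_set X C V)"])
      show "f \<in> domain_misses_set X U" using f fy UC by (auto simp: domain_misses_set_def)
      show "g \<in> inverted_set X (compact_open_set X C V)"
        using g i UC by (simp add: inverted_set_def compact_open_set_iff)
      fix a b assume ab: "a \<in> domain_misses_set X U" "b \<in> inverted_set X (compact_open_set X C V)"
      then have b: "b \<in> partial_homeos X" by (simp add: inverted_set_def)
      obtain z where z: "z \<in> U" "z \<notin> dom a" using ab by (auto simp: domain_misses_set_def)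
      then have "z \<in> partial_preimage (partial_inverse b) V"
        using ab UC by (auto simp: inverted_set_def compact_open_set_iff)
      then obtain w where "w \<in> V" "b w = Some z"
        by (auto simp: partial_preimage_def partial_inverse_eq_Some_iff[OF partial_homeos_inj[OF b]])
      then have "w \<in> V" "w \<notin> dom (a \<circ>\<^sub>m b)"
        using z by auto
      then show "a \<circ>\<^sub>m b \<in> domain_misses_set X V"
        using ab b by (auto simp: domain_misses_set_def partial_homeos_comp)
    qed (use UC V in \<open>auto intro: openin_tau_hco_domain_misses openin_tau_hco_inverted openin_tau_hco_compact_open\<close>)
  qed
qed

text \<open>The two preceding lemmas settle the sets in \<^term>\<open>domain_subbasis X\<close>. Their inverses follow by
  precomposing with the continuous map \<open>(f, g) \<mapsto> (g\<^sup>-\<^sup>1, f\<^sup>-\<^sup>1)\<close>.\<close>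

lemma continuous_map_composition_tau_hco:
  assumes lc: "locally_compact_space X" and H: "Hausdorff_space X"
  shows "continuous_map (prod_topology (tau_hco X) (tau_hco X)) (tau_hco X) (\<lambda>(f, g). f \<circ>\<^sub>m g)"
proof -
  let ?P = "prod_topology (tau_hco X) (tau_hco X)"
  have P: "topspace ?P = partial_homeos X \<times> partial_homeos X"
    by (simp add: topspace_tau_hco)
  have direct: "openin ?P {(f, g). f \<in> partial_homeos X \<and> g \<in> partial_homeos X \<and> f \<circ>\<^sub>m g \<in> S}"
    if S: "S \<in> domain_subbasis X" for S
    unfolding openin_prod_topology_alt
  proof (intro allI impI)
    fix f g assume "(f, g) \<in> {(f, g). f \<in> partial_homeos X \<and> g \<in> partial_homeos X \<and> f \<circ>\<^sub>m g \<in> S}"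
    then have fg: "f \<in> partial_homeos X" "g \<in> partial_homeos X" "f \<circ>\<^sub>m g \<in> S" by auto
    obtain A B where AB: "openin (tau_hco X) A" "openin (tau_hco X) B" "f \<in> A" "g \<in> B"
      "\<And>a b. a \<in> A \<Longrightarrow> b \<in> B \<Longrightarrow> a \<circ>\<^sub>m b \<in> S"
    proof -
      consider K V where "compactin X K" "openin X V" "S = compact_open_set X K V"
        | V where "openin X V" "S = domain_misses_set X V"
        using S unfolding domain_subbasis_def by blast
      then show ?thesis
      proof cases
        case (1 K V)
        show ?thesis
          by (rule multiplication_nbhd_compact_open[OF lc H fg(1,2) 1(1,2) fg(3)[unfolded 1(3)]])
            (rule that, auto simp: 1(3))
      next
        case (2 V)
        show ?thesis
          by (rule multiplication_nbhd_domain_misses[OF lc H fg(1,2) 2(1) fg(3)[unfolded 2(2)]])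
            (rule that, auto simp: 2(2))
      qed
    qed
    have "A \<subseteq> partial_homeos X" "B \<subseteq> partial_homeos X"
      using AB(1,2) openin_subset topspace_tau_hco by blast+
    then show "\<exists>U V. openin (tau_hco X) U \<and> openin (tau_hco X) V \<and> f \<in> U \<and> g \<in> V \<and>
        U \<times> V \<subseteq> {(f, g). f \<in> partial_homeos X \<and> g \<in> partial_homeos X \<and> f \<circ>\<^sub>m g \<in> S}"
      using AB by (intro exI[of _ A] exI[of _ B]) auto
  qed
  have swap: "continuous_map ?P ?P (\<lambda>(f, g). (partial_inverse g, partial_inverse f))"
    unfolding case_prod_unfold
    by (intro continuous_map_pairedI
        continuous_map_compose[OF continuous_map_snd continuous_map_partial_inverse_tau_hco, unfolded comp_def]
        continuous_map_compose[OF continuous_map_fst continuous_map_partial_inverse_tau_hco, unfolded comp_def])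
  have "continuous_map ?P (topology_generated_by (hco_subbasis X)) (\<lambda>(f, g). f \<circ>\<^sub>m g)"
  proof (rule continuous_on_generated_topo)
    fix S assume "S \<in> hco_subbasis X"
    then consider "S \<in> domain_subbasis X"
      | R where "R \<in> domain_subbasis X" "S = inverted_set X R"
      unfolding hco_subbasis_def by blast
    then show "openin ?P ((\<lambda>(f, g). f \<circ>\<^sub>m g) -` S \<inter> topspace ?P)"
    proof cases
      case 1
      have "(\<lambda>(f, g). f \<circ>\<^sub>m g) -` S \<inter> topspace ?P =
        {(f, g). f \<in> partial_homeos X \<and> g \<in> partial_homeos X \<and> f \<circ>\<^sub>m g \<in> S}"
        unfolding P by auto
      then show ?thesis using direct[OF 1] by simp
    next
      case (2 R)
      have "(\<lambda>(f, g). f \<circ>\<^sub>m g) -` S \<inter> topspace ?P =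
        {p \<in> topspace ?P. (\<lambda>(f, g). (partial_inverse g, partial_inverse f)) p \<in>
          {(f, g). f \<in> partial_homeos X \<and> g \<in> partial_homeos X \<and> f \<circ>\<^sub>m g \<in> R}}"
        unfolding P 2(2) inverted_set_def
        by (auto simp: partial_inverse_map_comp partial_homeos_inj partial_homeos_inverse partial_homeos_comp)
      then show ?thesis
        using openin_continuous_map_preimage[OF swap direct[OF 2(1)]] by simp
    qed
  next
    show "(\<lambda>(f, g). f \<circ>\<^sub>m g) ` topspace ?P \<subseteq> \<Union>(hco_subbasis X)"
      unfolding P Union_hco_subbasis by (auto simp: partial_homeos_comp)
  qed
  then show ?thesis by (simp only: tau_hco_eq)
qed

text \<open>For \<^term>\<open>V = topspace X\<close> this is openness of the domain of evaluation; for general \<open>V\<close> it is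
  continuity of evaluation on that domain.\<close>

lemma openin_evaluation_preimage_tau_hco:
  assumes lc: "locally_compact_space X" and H: "Hausdorff_space X" and V: "openin X V"
  shows "openin (prod_topology (tau_hco X) X) {p \<in> eval_domain X. eval_map p \<in> V}"
  unfolding openin_prod_topology_alt
proof (intro allI impI)
  fix f x assume "(f, x) \<in> {p \<in> eval_domain X. eval_map p \<in> V}"
  then have f: "f \<in> partial_homeos X" and x: "x \<in> partial_preimage f V"
    by (auto simp: eval_domain_def eval_map_def partial_preimage_def)
  have "x \<in> topspace X" using openin_subset[OF openin_partial_preimage[OF f V]] x by blast
  then obtain U C where UC: "openin X U" "compactin X C" "x \<in> U" "U \<subseteq> C" "C \<subseteq> partial_preimage f V"
    using compact_neighbourhood_between[OF lc H _ openin_partial_preimage[OF f V], of "{x}"] x by auto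
  have "f \<in> compact_open_set X C V" using f UC by (simp add: compact_open_set_iff)
  moreover have "compact_open_set X C V \<times> U \<subseteq> {p \<in> eval_domain X. eval_map p \<in> V}"
    using UC(4) by (auto simp: compact_open_set_def eval_domain_def eval_map_def)
  ultimately show "\<exists>A U. openin (tau_hco X) A \<and> openin X U \<and> f \<in> A \<and> x \<in> U \<and>
      A \<times> U \<subseteq> {p \<in> eval_domain X. eval_map p \<in> V}"
    using openin_tau_hco_compact_open[OF UC(2) V] UC(1,3) by blast
qed

proposition admissible_tau_hco:
  assumes lc: "locally_compact_space X" and H: "Hausdorff_space X"
  shows "admissible_topology X (tau_hco X)"
proof -
  let ?P = "prod_topology (tau_hco X) X"
  have val: "eval_map p \<in> topspace X" if "p \<in> eval_domain X" for p
    using that by (auto simp: eval_domain_def eval_map_def partial_homeos_iff intro: ranI)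
  then have "{p \<in> eval_domain X. eval_map p \<in> topspace X} = eval_domain X" by blast
  then have op: "openin ?P (eval_domain X)"
    using openin_evaluation_preimage_tau_hco[OF lc H openin_topspace] by metis
  then have ts: "topspace (subtopology ?P (eval_domain X)) = eval_domain X"
    by (intro topspace_subtopology_subset openin_subset)
  have ev: "continuous_map (subtopology ?P (eval_domain X)) X eval_map"
    unfolding continuous_map ts
    using val openin_evaluation_preimage_tau_hco[OF lc H] op by (auto simp: openin_open_subtopology)
  have "continuous_map (tau_hco X) (tau_hco X) (semigroup_inverse (partial_homeos X) (\<circ>\<^sub>m))"
    by (rule continuous_map_eq[OF continuous_map_partial_inverse_tau_hco])
      (simp add: topspace_tau_hco semigroup_inverse_partial_homeos)
  then have tis: "topological_inverse_semigroup (tau_hco X) (\<circ>\<^sub>m)"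
    unfolding topological_inverse_semigroup_def topspace_tau_hco
    using inverse_semigroup_partial_homeos continuous_map_composition_tau_hco[OF lc H] by blast
  show ?thesis
    unfolding admissible_topology_def
    using topspace_tau_hco Hausdorff_tau_hco[OF lc H] tis ev op by blast
qed

section \<open>Minimality\<close>

lemma continuous_map_partial_inverse_admissible:
  assumes "admissible_topology X T"
  shows "continuous_map T T partial_inverse"
  using assms unfolding admissible_topology_def topological_inverse_semigroup_def
  by (auto elim!: continuous_map_eq simp: semigroup_inverse_partial_homeos)

text \<open>The pairs \<open>(f, x)\<close> with \<open>f x \<in> V\<close> form an open set of the product. If it contains \<open>{f} \<times> K\<close>,
  then by compactness it contains \<open>A \<times> K\<close> for some neighbourhood \<open>A\<close> of \<open>f\<close>.\<close>

lemma openin_admissible_compact_open: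
  assumes T: "admissible_topology X T" and K: "compactin X K" and V: "openin X V"
  shows "openin T (compact_open_set X K V)"
proof -
  let ?P = "prod_topology T X" and ?W = "{p \<in> eval_domain X. eval_map p \<in> V}"
  have ts: "topspace T = partial_homeos X"
    and cont: "continuous_map (subtopology ?P (eval_domain X)) X eval_map"
    and op: "openin ?P (eval_domain X)"
    using T by (auto simp: admissible_topology_def)
  have "topspace (subtopology ?P (eval_domain X)) = eval_domain X"
    by (intro topspace_subtopology_subset openin_subset op)
  then have W: "openin ?P ?W"
    using openin_continuous_map_preimage[OF cont V] op by (simp add: openin_open_subtopology)
  show ?thesis
  proof (subst openin_subopen, intro ballI)
    fix f assume f: "f \<in> compact_open_set X K V"
    then have "f \<in> topspace T" "{f} \<times> K \<subseteq> ?W"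
      by (auto simp: ts compact_open_set_def eval_domain_def eval_map_def)
    then obtain A B where AB: "openin T A" "openin X B" "{f} \<subseteq> A" "K \<subseteq> B" "A \<times> B \<subseteq> ?W"
      using Wallace_theorem_prod_topology[of T "{f}" X K ?W] K W by auto
    have "A \<subseteq> compact_open_set X K V"
    proof
      fix a assume a: "a \<in> A"
      then have "a \<in> partial_homeos X" using AB(1) ts openin_subset by blast
      moreover have "(a, x) \<in> ?W" if "x \<in> K" for x using AB a that by blast
      ultimately show "a \<in> compact_open_set X K V"
        unfolding compact_open_set_def eval_domain_def eval_map_def by auto
    qed
    then show "\<exists>A. openin T A \<and> f \<in> A \<and> A \<subseteq> compact_open_set X K V" using AB by blast
  qed
qed

text \<open>The product \<open>f\<^sup>-\<^sup>1 f\<close> is the identity on \<open>dom f\<close>, so multiplying it by the identity on \<open>V\<close>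
  gives the identity on \<open>V \<inter> dom f\<close>.\<close>

lemma subset_dom_iff_idempotent:
  assumes "inj_on f (dom f)"
  shows "V \<subseteq> dom f \<longleftrightarrow> (partial_inverse f \<circ>\<^sub>m f) \<circ>\<^sub>m (Some |` V) = Some |` V"
proof -
  have *: "((partial_inverse f \<circ>\<^sub>m f) \<circ>\<^sub>m (Some |` V)) x = (if x \<in> V \<inter> dom f then Some x else None)" for x
  proof (cases "f x")
    case None
    then show ?thesis by (auto simp: restrict_map_def map_comp_def)
  next
    case (Some y)
    then have "partial_inverse f y = Some x" using assms by (simp add: partial_inverse_eq_Some_iff)
    then show ?thesis using Some by (auto simp: restrict_map_def map_comp_def)
  qed
  show ?thesis unfolding fun_eq_iff * by (auto simp: restrict_map_def split: if_splits)
qed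

text \<open>By the preceding lemma the complement is the fibre of the continuous map
  \<open>f \<mapsto> f\<^sup>-\<^sup>1 f e\<close> over \<open>e\<close>, the identity on \<open>V\<close>, and points are closed in \<open>T\<close>.\<close>

lemma openin_admissible_domain_misses:
  assumes T: "admissible_topology X T" and V: "openin X V"
  shows "openin T (domain_misses_set X V)"
proof -
  let ?e = "Some |` V"
  have ts: "topspace T = partial_homeos X" and H: "Hausdorff_space T"
    and mul: "continuous_map (prod_topology T T) T (\<lambda>(a, b). a \<circ>\<^sub>m b)"
    using T by (auto simp: admissible_topology_def topological_inverse_semigroup_def)
  have mulI: "continuous_map T T (\<lambda>f. a f \<circ>\<^sub>m b f)"
    if "continuous_map T T a" "continuous_map T T b" for a b
    using continuous_map_compose[OF continuous_map_pairedI[OF that] mul] by (simp add: comp_def)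
  have e: "?e \<in> topspace T" using restricted_identity_in_partial_homeos[OF V] ts by simp
  have cont: "continuous_map T T (\<lambda>f. (partial_inverse f \<circ>\<^sub>m f) \<circ>\<^sub>m ?e)"
    using e by (intro mulI continuous_map_partial_inverse_admissible[OF T]) auto
  have "openin T (topspace T - {?e})"
    using closedin_Hausdorff_singleton[OF H e] by blast
  from openin_continuous_map_preimage[OF cont this]
  have "openin T {f \<in> topspace T. (partial_inverse f \<circ>\<^sub>m f) \<circ>\<^sub>m ?e \<in> topspace T - {?e}}" .
  also have "{f \<in> topspace T. (partial_inverse f \<circ>\<^sub>m f) \<circ>\<^sub>m ?e \<in> topspace T - {?e}} = domain_misses_set X V"
  proof -
    have "(partial_inverse f \<circ>\<^sub>m f) \<circ>\<^sub>m ?e \<in> topspace T - {?e} \<longleftrightarrow> \<not> V \<subseteq> dom f"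
      if "f \<in> partial_homeos X" for f
      unfolding ts subset_dom_iff_idempotent[OF partial_homeos_inj[OF that]]
      using that e by (simp add: ts partial_homeos_comp partial_homeos_inverse)
    then show ?thesis unfolding ts domain_misses_set_def by blast
  qed
  finally show ?thesis .
qed

proposition tau_hco_coarsest_admissible:
  assumes T: "admissible_topology X T" and U: "openin (tau_hco X) U"
  shows "openin T U"
proof (rule openin_generated_minimal[OF _ U[unfolded tau_hco_eq]])
  have dir: "openin T S" if "S \<in> domain_subbasis X" for S
    using that openin_admissible_compact_open[OF T] openin_admissible_domain_misses[OF T]
    by (auto simp: domain_subbasis_def)
  have ts: "topspace T = partial_homeos X" using T by (simp add: admissible_topology_def)
  have "openin T (inverted_set X S)" if "S \<in> domain_subbasis X" for S
    using openin_continuous_map_preimage[OF continuous_map_partial_inverse_admissible[OF T] dir[OF that]]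
    by (simp add: inverted_set_def ts)
  then show "openin T S" if "S \<in> hco_subbasis X" for S
    using that dir by (auto simp: hco_subbasis_def)
qed

theorem theorem3p11:
  fixes X :: "'a topology"
  assumes "locally_compact_space X" and "Hausdorff_space X"
  shows "admissible_topology X (tau_hco X) \<and>
    (\<forall>T. admissible_topology X T \<longrightarrow> (\<forall>U. openin (tau_hco X) U \<longrightarrow> openin T U))"
  using admissible_tau_hco[OF assms] tau_hco_coarsest_admissible by blast

end
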